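(* Let $0<a<b<c<d<f<e$ be real numbers such that both matrices $$S_1=\begin{pmatrix} 0 & a & b & d \\ a & 0 & c & e \\ b & c & 0 & f \\ d & e & f & 0 \end{pmatrix},\qquad S_2=\begin{pmatrix} 0 & a & b & f \\ a & 0 & c & e \\ b & c & 0 & d \\ f & e & d & 0 \end{pmatrix}$$ satisfy the triangle inequalities, and let $X_i$ be the four-point metric space $\{x_1,x_2,x_3,x_4\}$ with distance matrix $S_i$, $i=1,2$. Then the Gromov--Hausdorff distances from $X_1$ and from $X_2$ to any simplex are the same, i.e. $d_{GH}(t\Delta_m,X_1)=d_{GH}(t\Delta_m,X_2)$ for all $t>0$ and all $m\in\mathbb{N}$.
   Context: $\mathbb{N}=\{1,2,\ldots\}$ and $d_{GH}$ is the Gromov--Hausdorff distance. A simplex here is a finite metric space all of whose nonzero distances are equal; $t\Delta_m$ denotes the simplex with $m$ points and all nonzero distances equal to $t$. A space with distance matrix $S=(s_{ij})$ has $|x_ix_j|=s_{ij}$. *)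

theory Defs
  imports "HOL-Analysis.Analysis"
begin

text \<open>The Hausdorff distance is extended-real-valued, so that it is \<open>\<infinity>\<close> (and not an arbitrary
  real number) if no finite \<open>r\<close> is admissible.\<close>

definition hausdorff_dist :: "'a metric \<Rightarrow> 'a set \<Rightarrow> 'a set \<Rightarrow> ereal" where
  "hausdorff_dist Z A B =
     Inf {ereal r | r. r > 0 \<and> A \<subseteq> (\<Union>b\<in>B. mball_of Z b r) \<and> B \<subseteq> (\<Union>a\<in>A. mball_of Z a r)}"

definition isometric_to_subset :: "'a metric \<Rightarrow> 'c metric \<Rightarrow> 'c set \<Rightarrow> bool" where
  "isometric_to_subset X Z A \<longleftrightarrow> A \<subseteq> mspace Z \<and>
     (\<exists>f. f ` mspace X = A \<and>
          (\<forall>x\<in>mspace X. \<forall>y\<in>mspace X. mdist Z (f x) (f y) = mdist X x y))"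

text \<open>The infimum of the Hausdorff distances over all realizations of the pair \<open>X\<close>, \<open>Y\<close> as
  subsets of a common metric space \<open>Z\<close>. Since \<open>Z\<close> may be cut down to the union of the two subsets,
  it suffices to let \<open>Z\<close> range over the metric spaces whose points are taken from the sum type;
  \<open>gromov_hausdorff_le\<close> below shows that ambient spaces over other types do not yield smaller
  values.\<close>

definition gromov_hausdorff :: "'a metric \<Rightarrow> 'b metric \<Rightarrow> ereal" where
  "gromov_hausdorff X Y =
     Inf {hausdorff_dist Z A B | (Z :: ('a + 'b) metric) A B.
            isometric_to_subset X Z A \<and> isometric_to_subset Y Z B}"

lemma gromov_hausdorff_le:
  fixes X :: "'a metric" and Y :: "'b metric" and Z :: "'c metric"
  assumes A: "isometric_to_subset X Z A" and B: "isometric_to_subset Y Z B"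
  shows "gromov_hausdorff X Y \<le> hausdorff_dist Z A B"
proof -
  obtain f where AZ: "A \<subseteq> mspace Z" and fA: "f ` mspace X = A"
    and f: "\<And>x y. x \<in> mspace X \<Longrightarrow> y \<in> mspace X \<Longrightarrow> mdist Z (f x) (f y) = mdist X x y"
    using A by (auto simp: isometric_to_subset_def)
  obtain g where BZ: "B \<subseteq> mspace Z" and gB: "g ` mspace Y = B"
    and g: "\<And>x y. x \<in> mspace Y \<Longrightarrow> y \<in> mspace Y \<Longrightarrow> mdist Z (g x) (g y) = mdist Y x y"
    using B by (auto simp: isometric_to_subset_def)
  define k where "k = case_sum f g"
  define M where "M = Inl ` mspace X \<union> Inr ` {y \<in> mspace Y. g y \<notin> A}"
  define D where "D = (\<lambda>u v. mdist Z (k u) (k v))"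
  have f_inj: "x = y" if "x \<in> mspace X" "y \<in> mspace X" "f x = f y" for x y
    using that f[of x y] fA AZ by (metis image_eqI mdist_zero subsetD)
  have g_inj: "x = y" if "x \<in> mspace Y" "y \<in> mspace Y" "g x = g y" for x y
    using that g[of x y] gB BZ by (metis image_eqI mdist_zero subsetD)
  have k_inj: "u = v" if "u \<in> M" "v \<in> M" "k u = k v" for u v
  proof -
    have fA': "f x \<in> A" if "x \<in> mspace X" for x using that fA by blast
    show ?thesis
    proof (cases u)
      case (Inl x)
      then have x: "x \<in> mspace X" using that(1) by (auto simp: M_def)
      show ?thesis
      proof (cases v)
        case (Inl x')
        then have "x' \<in> mspace X" using that(2) by (auto simp: M_def)
        then show ?thesis using f_inj[OF x] that(3) \<open>u = Inl x\<close> Inl by (simp add: k_def)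
      next
        case (Inr y)
        then have "g y \<notin> A" using that(2) by (auto simp: M_def)
        then show ?thesis using fA'[OF x] that(3) \<open>u = Inl x\<close> Inr by (simp add: k_def)
      qed
    next
      case (Inr y)
      then have y: "y \<in> mspace Y" "g y \<notin> A" using that(1) by (auto simp: M_def)
      show ?thesis
      proof (cases v)
        case (Inl x)
        then have "x \<in> mspace X" using that(2) by (auto simp: M_def)
        then have "f x \<in> A" by (rule fA')
        then show ?thesis using y(2) that(3) \<open>u = Inr y\<close> Inl by (simp add: k_def)
      next
        case (Inr y')
        then have "y' \<in> mspace Y" using that(2) by (auto simp: M_def)
        then show ?thesis using g_inj[OF y(1)] that(3) \<open>u = Inr y\<close> Inr by (simp add: k_def)
      qed
    qed
  qed
  have kM: "k ` M = A \<union> B"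
  proof
    show "k ` M \<subseteq> A \<union> B" using fA gB by (auto simp: M_def k_def)
    show "A \<union> B \<subseteq> k ` M"
    proof
      fix z assume "z \<in> A \<union> B"
      then consider "z \<in> A" | "z \<notin> A" "z \<in> B" by blast
      then show "z \<in> k ` M"
      proof cases
        case 1
        then obtain x where "x \<in> mspace X" "z = f x" using fA by blast
        then show ?thesis by (intro image_eqI[of _ _ "Inl x"]) (auto simp: M_def k_def)
      next
        case 2
        then obtain y where "y \<in> mspace Y" "z = g y" using gB by blast
        with 2 show ?thesis by (intro image_eqI[of _ _ "Inr y"]) (auto simp: M_def k_def)
      qed
    qed
  qed
  then have kZ: "k u \<in> mspace Z" if "u \<in> M" for u using that AZ BZ by blast
  interpret MD: Metric_space M D
  proof
    fix u v w
    show "0 \<le> D u v" by (simp add: D_def)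
    show "D u v = D v u" by (simp add: D_def mdist_commute)
    show "D u v = 0 \<longleftrightarrow> u = v" if "u \<in> M" "v \<in> M"
      using that kZ k_inj by (auto simp: D_def)
    show "D u w \<le> D u v + D v w" if "u \<in> M" "v \<in> M" "w \<in> M"
      using that kZ by (auto simp: D_def mdist_triangle)
  qed
  define A' B' where "A' = {u \<in> M. k u \<in> A}" and "B' = {u \<in> M. k u \<in> B}"
  have A'M: "A' \<subseteq> M" and B'M: "B' \<subseteq> M" by (auto simp: A'_def B'_def)
  have kA': "k ` A' = A" and kB': "k ` B' = B"
  proof -
    have "k ` {u \<in> M. k u \<in> C} = C" if "C \<subseteq> k ` M" for C
      using that by (auto simp: image_iff subset_iff)
    then show "k ` A' = A" "k ` B' = B" unfolding A'_def B'_def kM by simp_all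
  qed
  have DS: "mdist MD.Self u v = mdist Z (k u) (k v)" for u v
    unfolding MD.mdist_Self by (simp add: D_def)
  have pull: "isometric_to_subset W MD.Self C'"
    if "C' \<subseteq> M" "h ` mspace W = k ` C'"
      "\<And>x y. x \<in> mspace W \<Longrightarrow> y \<in> mspace W \<Longrightarrow> mdist Z (h x) (h y) = mdist W x y"
    for W :: "'w metric" and h C'
  proof -
    define p where "p = (\<lambda>x. inv_into C' k (h x))"
    have inj: "inj_on k C'" using k_inj that(1) by (meson inj_onI subsetD)
    have kp: "k (p x) = h x" if "x \<in> mspace W" for x
      using that \<open>h ` mspace W = k ` C'\<close> unfolding p_def by (metis f_inv_into_f imageI)
    have "p ` mspace W = inv_into C' k ` k ` C'"
      by (simp add: p_def image_image flip: that(2))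
    also have "\<dots> = C'" using inj by (simp add: inv_into_image_cancel)
    finally have "p ` mspace W = C'" .
    moreover have "mdist MD.Self (p x) (p y) = mdist W x y"
      if "x \<in> mspace W" "y \<in> mspace W" for x y
      using that kp \<open>\<And>x y. x \<in> mspace W \<Longrightarrow> y \<in> mspace W \<Longrightarrow> mdist Z (h x) (h y) = mdist W x y\<close>
      by (simp add: DS del: MD.mdist_Self)
    ultimately show ?thesis using that(1) by (auto simp: isometric_to_subset_def)
  qed
  have "gromov_hausdorff X Y \<le> hausdorff_dist MD.Self A' B'"
  proof -
    have "isometric_to_subset X MD.Self A'" "isometric_to_subset Y MD.Self B'"
      using pull[OF A'M, of f X] pull[OF B'M, of g Y] f g fA gB kA' kB' by simp_all
    then show ?thesis unfolding gromov_hausdorff_def by (intro Inf_lower) blast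
  qed
  also have "\<dots> = hausdorff_dist Z A B"
  proof -
    have nb: "(C \<subseteq> (\<Union>b\<in>E. mball_of MD.Self b r)) \<longleftrightarrow> (k ` C \<subseteq> (\<Union>b\<in>k ` E. mball_of Z b r))"
      if "C \<subseteq> M" "E \<subseteq> M" for C E r
    proof -
      have "c \<in> mball_of MD.Self b r \<longleftrightarrow> k c \<in> mball_of Z (k b) r" if "c \<in> C" "b \<in> E" for b c
        using that \<open>C \<subseteq> M\<close> \<open>E \<subseteq> M\<close> kZ by (auto simp: DS simp del: MD.mdist_Self)
      then show ?thesis by (simp only: image_subset_iff subset_iff UN_iff bex_simps ball_simps) blast
    qed
    show ?thesis
      unfolding hausdorff_dist_def using nb[OF A'M B'M] nb[OF B'M A'M] kA' kB' by simp
  qed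
  finally show ?thesis .
qed

definition simplex_metric :: "real \<Rightarrow> nat \<Rightarrow> nat metric" where
  "simplex_metric t m = metric ({..<m}, \<lambda>i j. if i = j then 0 else t)"

lemma Metric_space_simplex:
  assumes "t > 0"
  shows "Metric_space {..<m::nat} (\<lambda>i j. if i = j then 0 else t)"
  using assms by unfold_locales auto

definition triangle_ineqs :: "real^'n^'n \<Rightarrow> bool" where
  "triangle_ineqs S \<longleftrightarrow> (\<forall>i j k. S $ i $ k \<le> S $ i $ j + S $ j $ k)"

text \<open>The constant \<open>metric\<close> is only meaningful on pairs that form a metric space, so
  \<open>matrix_metric S\<close> has the intended meaning only if \<open>S\<close> is symmetric with zero diagonal, positive
  off-diagonal entries and the triangle inequalities.\<close>

definition matrix_metric :: "real^'n^'n \<Rightarrow> 'n metric" where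
  "matrix_metric S = metric (UNIV, \<lambda>i j. S $ i $ j)"

lemma Metric_space_matrix:
  assumes "triangle_ineqs S" and "\<And>i j. S $ i $ j = S $ j $ i" and "\<And>i. S $ i $ i = 0"
    and "\<And>i j. i \<noteq> j \<Longrightarrow> S $ i $ j > 0"
  shows "Metric_space UNIV (\<lambda>i j. S $ i $ j)"
proof
  fix i j k
  show "0 \<le> S $ i $ j" using assms(3)[of i] assms(4)[of i j] by (cases "i = j") auto
  show "S $ i $ j = S $ j $ i" by (rule assms(2))
  show "S $ i $ j = 0 \<longleftrightarrow> i = j" using assms(3)[of i] assms(4)[of i j] by (cases "i = j") auto
  show "S $ i $ k \<le> S $ i $ j + S $ j $ k" using assms(1) by (auto simp: triangle_ineqs_def)
qed

definition matrix_S1 :: "real \<Rightarrow> real \<Rightarrow> real \<Rightarrow> real \<Rightarrow> real \<Rightarrow> real \<Rightarrow> real^4^4" where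
  "matrix_S1 a b c d e f = vector
     [vector [0, a, b, d],
      vector [a, 0, c, e],
      vector [b, c, 0, f],
      vector [d, e, f, 0]]"

definition matrix_S2 :: "real \<Rightarrow> real \<Rightarrow> real \<Rightarrow> real \<Rightarrow> real \<Rightarrow> real \<Rightarrow> real^4^4" where
  "matrix_S2 a b c d e f = vector
     [vector [0, a, b, f],
      vector [a, 0, c, e],
      vector [b, c, 0, d],
      vector [f, e, d, 0]]"

lemma vector_4:
  "(vector [w, x, y, z] :: 'a::zero^4) $ 1 = w"
  "(vector [w, x, y, z] :: 'a::zero^4) $ 2 = x"
  "(vector [w, x, y, z] :: 'a::zero^4) $ 3 = y"
  "(vector [w, x, y, z] :: 'a::zero^4) $ 4 = z"
  by (simp_all add: vector_def)

lemma Metric_space_S1: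
  assumes "0 < a" "a < b" "b < c" "c < d" "d < f" "f < e"
    and "triangle_ineqs (matrix_S1 a b c d e f)"
  shows "Metric_space UNIV (\<lambda>i j. matrix_S1 a b c d e f $ i $ j)"
proof (rule Metric_space_matrix)
  let ?S = "matrix_S1 a b c d e f"
  have pos: "0 < b" "0 < c" "0 < d" "0 < e" "0 < f" using assms(1-6) by linarith+
  have "\<forall>i j. ?S $ i $ j = ?S $ j $ i" "\<forall>i. ?S $ i $ i = 0"
    unfolding matrix_S1_def forall_4 vector_4 by blast+
  then show "?S $ i $ j = ?S $ j $ i" "?S $ i $ i = 0" for i j by blast+
  have "\<forall>i j. i \<noteq> j \<longrightarrow> ?S $ i $ j > 0"
    unfolding matrix_S1_def forall_4 vector_4 using pos assms(1) by blast
  then show "?S $ i $ j > 0" if "i \<noteq> j" for i j using that by blast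
qed (fact assms(7))

lemma Metric_space_S2:
  assumes "0 < a" "a < b" "b < c" "c < d" "d < f" "f < e"
    and "triangle_ineqs (matrix_S2 a b c d e f)"
  shows "Metric_space UNIV (\<lambda>i j. matrix_S2 a b c d e f $ i $ j)"
proof (rule Metric_space_matrix)
  let ?S = "matrix_S2 a b c d e f"
  have pos: "0 < b" "0 < c" "0 < d" "0 < e" "0 < f" using assms(1-6) by linarith+
  have "\<forall>i j. ?S $ i $ j = ?S $ j $ i" "\<forall>i. ?S $ i $ i = 0"
    unfolding matrix_S2_def forall_4 vector_4 by blast+
  then show "?S $ i $ j = ?S $ j $ i" "?S $ i $ i = 0" for i j by blast+
  have "\<forall>i j. i \<noteq> j \<longrightarrow> ?S $ i $ j > 0"
    unfolding matrix_S2_def forall_4 vector_4 using pos assms(1) by blast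
  then show "?S $ i $ j > 0" if "i \<noteq> j" for i j using that by blast
qed (fact assms(7))

end

theory Submission
  imports Defs
begin

text \<open>The Gromov--Hausdorff distance is half the smallest distortion of a correspondence
  (\<open>gromov_hausdorff_eq_correspondence\<close>). A correspondence between a simplex with \<open>m\<close> points and
  a four-point space covers the space by \<open>m\<close> clusters; its distortion is small if the clusters
  have small diameter, distinct clusters lie far apart, and \<open>t\<close> is not much smaller than the
  diameter \<open>e\<close>.

  The matrices differ by exchanging \<open>d\<close> and \<open>f\<close> in the distances from \<open>4\<close> to \<open>1\<close> and \<open>3\<close>.
  In both spaces the partitions \<open>4 | 123\<close>, \<open>4 | 3 | 12\<close> and \<open>4 | 3 | 2 | 1\<close> have at the same
  time the least possible diameter of the parts (\<open>c\<close>, \<open>a\<close>, \<open>0\<close>) and the greatest possible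
  separation (\<open>d\<close>, \<open>b\<close>, \<open>a\<close>) among all partitions with that number of parts. These numbers
  involve only the smaller of the distances from \<open>4\<close> to \<open>1\<close> and \<open>3\<close>, so they are blind to the
  exchange. The locale \<open>four_point_metric\<close> captures what the spaces have in common:
  \<open>distortion_lower_bound\<close> shows that no correspondence beats these partitions, and
  \<open>correspondence_attaining_bound\<close> that they attain the bound.\<close>

section \<open>Gromov--Hausdorff distance and correspondences\<close>

definition correspondence :: "'a set \<Rightarrow> 'b set \<Rightarrow> ('a \<times> 'b) set \<Rightarrow> bool" where
  "correspondence A B R \<longleftrightarrow> fst ` R = A \<and> snd ` R = B"

definition distortion_le :: "'a metric \<Rightarrow> 'b metric \<Rightarrow> ('a \<times> 'b) set \<Rightarrow> real \<Rightarrow> bool" where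
  "distortion_le X Y R s \<longleftrightarrow>
     (\<forall>(x, y)\<in>R. \<forall>(x', y')\<in>R. \<bar>mdist X x x' - mdist Y y y'\<bar> \<le> s)"

lemma distortion_leD:
  "distortion_le X Y R s \<Longrightarrow> (x, y) \<in> R \<Longrightarrow> (x', y') \<in> R \<Longrightarrow>
    \<bar>mdist X x x' - mdist Y y y'\<bar> \<le> s"
  by (auto simp: distortion_le_def)

lemma correspondenceD:
  assumes "correspondence A B R"
  shows "(x, y) \<in> R \<Longrightarrow> x \<in> A" and "(x, y) \<in> R \<Longrightarrow> y \<in> B"
    and "x \<in> A \<Longrightarrow> \<exists>y. (x, y) \<in> R" and "y \<in> B \<Longrightarrow> \<exists>x. (x, y) \<in> R"
  using assms by (force simp: correspondence_def)+

lemma mdist_self: "x \<in> mspace X \<Longrightarrow> mdist X x x = 0"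
  by simp

text \<open>Points of the two copies that are less than \<open>r\<close> apart form a correspondence: replacing both
  ends of a segment by related points changes its length by less than \<open>r\<close> at each end.\<close>

lemma correspondence_of_realization:
  fixes Z :: "'c metric"
  assumes A: "isometric_to_subset X Z A" and B: "isometric_to_subset Y Z B"
    and AB: "A \<subseteq> (\<Union>b\<in>B. mball_of Z b r)" and BA: "B \<subseteq> (\<Union>a\<in>A. mball_of Z a r)"
  shows "\<exists>R. correspondence (mspace X) (mspace Y) R \<and> distortion_le X Y R (2 * r)"
proof -
  obtain f where AZ: "A \<subseteq> mspace Z" and fA: "f ` mspace X = A"
    and f: "\<And>x y. x \<in> mspace X \<Longrightarrow> y \<in> mspace X \<Longrightarrow> mdist Z (f x) (f y) = mdist X x y"
    using A by (auto simp: isometric_to_subset_def)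
  obtain g where BZ: "B \<subseteq> mspace Z" and gB: "g ` mspace Y = B"
    and g: "\<And>x y. x \<in> mspace Y \<Longrightarrow> y \<in> mspace Y \<Longrightarrow> mdist Z (g x) (g y) = mdist Y x y"
    using B by (auto simp: isometric_to_subset_def)
  have fZ: "f x \<in> mspace Z" if "x \<in> mspace X" for x using that fA AZ by blast
  have gZ: "g y \<in> mspace Z" if "y \<in> mspace Y" for y using that gB BZ by blast
  define R where "R = {(x, y). x \<in> mspace X \<and> y \<in> mspace Y \<and> mdist Z (f x) (g y) < r}"
  have "\<exists>y\<in>mspace Y. mdist Z (f x) (g y) < r" if "x \<in> mspace X" for x
  proof -
    have "f x \<in> (\<Union>b\<in>B. mball_of Z b r)" using AB fA that by blast
    then obtain y where "y \<in> mspace Y" "f x \<in> mball_of Z (g y) r" using gB by blast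
    then show ?thesis by (auto simp: mdist_commute)
  qed
  moreover have "\<exists>x\<in>mspace X. mdist Z (f x) (g y) < r" if "y \<in> mspace Y" for y
  proof -
    have "g y \<in> (\<Union>a\<in>A. mball_of Z a r)" using BA gB that by blast
    then obtain x where "x \<in> mspace X" "g y \<in> mball_of Z (f x) r" using fA by blast
    then show ?thesis by auto
  qed
  ultimately have "correspondence (mspace X) (mspace Y) R"
    unfolding correspondence_def R_def by (fastforce simp: image_iff)
  moreover have "distortion_le X Y R (2 * r)"
    unfolding distortion_le_def
  proof clarify
    fix x y x' y' assume "(x, y) \<in> R" and "(x', y') \<in> R"
    then have *: "x \<in> mspace X" "y \<in> mspace Y" "x' \<in> mspace X" "y' \<in> mspace Y"
      "mdist Z (f x) (g y) < r" "mdist Z (f x') (g y') < r"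
      by (auto simp: R_def)
    have "mdist Z (f x) (f x') \<le> mdist Z (f x) (g y) + (mdist Z (g y) (g y') + mdist Z (g y') (f x'))"
      using mdist_triangle[of "f x" Z "g y" "f x'"] mdist_triangle[of "g y" Z "g y'" "f x'"] * fZ gZ
      by fastforce
    moreover have "mdist Z (g y) (g y') \<le> mdist Z (g y) (f x) + (mdist Z (f x) (f x') + mdist Z (f x') (g y'))"
      using mdist_triangle[of "g y" Z "f x" "g y'"] mdist_triangle[of "f x" Z "f x'" "g y'"] * fZ gZ
      by fastforce
    ultimately show "\<bar>mdist X x x' - mdist Y y y'\<bar> \<le> 2 * r"
      using *(5,6) f[OF *(1,3)] g[OF *(2,4)] mdist_commute[of Z "g y" "f x"]
        mdist_commute[of Z "g y'" "f x'"] by linarith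
  qed
  ultimately show ?thesis by blast
qed

text \<open>The two spaces are glued along \<open>R\<close> by joining related points with bridges of length \<open>r\<close>; a
  path from one space to the other uses the best bridge. Two bridges have total length \<open>2 * r\<close>,
  which is at least the distortion, so a detour through the other space is never a shortcut.\<close>

lemma gromov_hausdorff_le_correspondence:
  fixes X :: "'a metric" and Y :: "'b metric"
  assumes R: "correspondence (mspace X) (mspace Y) R" and dis: "distortion_le X Y R (2 * r)"
    and r: "r > 0" and ne: "mspace X \<noteq> {}"
  shows "gromov_hausdorff X Y \<le> ereal r"
proof -
  have "R \<noteq> {}" using R ne by (auto simp: correspondence_def)
  note RX = correspondenceD(1)[OF R] and RY = correspondenceD(2)[OF R]
  define h where "h = (\<lambda>x y. INF (x', y')\<in>R. mdist X x x' + mdist Y y' y)"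
  have h_le: "h x y \<le> mdist X x x' + mdist Y y' y" if "(x', y') \<in> R" for x y x' y'
  proof -
    have "bdd_below ((\<lambda>(x', y'). mdist X x x' + mdist Y y' y) ` R)"
      by (rule bdd_belowI[of _ 0]) auto
    from cINF_lower[OF this that] show ?thesis by (simp add: h_def)
  qed
  have h_ge: "u \<le> h x y" if "\<And>x' y'. (x', y') \<in> R \<Longrightarrow> u \<le> mdist X x x' + mdist Y y' y" for u x y
    unfolding h_def using \<open>R \<noteq> {}\<close> that by (intro cINF_greatest) auto
  have h_nonneg: "0 \<le> h x y" for x y by (rule h_ge) simp
  have hX: "h x y \<le> mdist X x z + h z y" if "x \<in> mspace X" "z \<in> mspace X" for x y z
  proof -
    have "h x y - mdist X x z \<le> h z y"
      by (rule h_ge) (use that h_le[of _ _ x y] mdist_triangle[of x X z] RX in fastforce)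
    then show ?thesis by simp
  qed
  have hY: "h x y \<le> h x z + mdist Y z y" if "y \<in> mspace Y" "z \<in> mspace Y" for x y z
  proof -
    have "h x y - mdist Y z y \<le> h x z"
      by (rule h_ge) (use that h_le[of _ _ x y] mdist_triangle[of _ Y z y] RY in fastforce)
    then show ?thesis by simp
  qed
  have XX: "mdist X x z \<le> 2 * r + h x y + h z y"
    if "x \<in> mspace X" "z \<in> mspace X" "y \<in> mspace Y" for x z y
  proof -
    have "mdist X x z - 2 * r - h z y \<le> h x y"
    proof (rule h_ge)
      fix u v assume uv: "(u, v) \<in> R"
      have "mdist X x z - 2 * r - (mdist X x u + mdist Y v y) \<le> h z y"
      proof (rule h_ge)
        fix u' v' assume uv': "(u', v') \<in> R"
        have "mdist X x z \<le> mdist X x u + (mdist X u u' + mdist X z u')"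
          using mdist_triangle[of x X u z] mdist_triangle[of u X u' z] mdist_commute[of X u' z]
            that RX uv uv' by fastforce
        moreover have "mdist Y v v' \<le> mdist Y v y + mdist Y v' y"
          using mdist_triangle[of v Y y v'] mdist_commute[of Y y v'] that RY uv uv' by fastforce
        ultimately show "mdist X x z - 2 * r - (mdist X x u + mdist Y v y)
            \<le> mdist X z u' + mdist Y v' y"
          using distortion_leD[OF dis uv uv'] by linarith
      qed
      then show "mdist X x z - 2 * r - h z y \<le> mdist X x u + mdist Y v y" by linarith
    qed
    then show ?thesis by linarith
  qed
  have YY: "mdist Y y z \<le> 2 * r + h x y + h x z"
    if "y \<in> mspace Y" "z \<in> mspace Y" "x \<in> mspace X" for x z y
  proof -
    have "mdist Y y z - 2 * r - h x z \<le> h x y"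
    proof (rule h_ge)
      fix u v assume uv: "(u, v) \<in> R"
      have "mdist Y y z - 2 * r - (mdist X x u + mdist Y v y) \<le> h x z"
      proof (rule h_ge)
        fix u' v' assume uv': "(u', v') \<in> R"
        have "mdist Y y z \<le> mdist Y v y + (mdist Y v v' + mdist Y v' z)"
          using mdist_triangle[of y Y v z] mdist_triangle[of v Y v' z] mdist_commute[of Y y v]
            that RY uv uv' by fastforce
        moreover have "mdist X u u' \<le> mdist X x u + mdist X x u'"
          using mdist_triangle[of u X x u'] mdist_commute[of X u x] that RX uv uv' by fastforce
        ultimately show "mdist Y y z - 2 * r - (mdist X x u + mdist Y v y)
            \<le> mdist X x u' + mdist Y v' z"
          using distortion_leD[OF dis uv uv'] by linarith
      qed
      then show "mdist Y y z - 2 * r - h x z \<le> mdist X x u + mdist Y v y" by linarith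
    qed
    then show ?thesis by linarith
  qed
  define M where "M = Inl ` mspace X \<union> Inr ` mspace Y"
  define D where "D = (\<lambda>u v. case u of
      Inl x \<Rightarrow> (case v of Inl x' \<Rightarrow> mdist X x x' | Inr y \<Rightarrow> r + h x y)
    | Inr y \<Rightarrow> (case v of Inl x \<Rightarrow> r + h x y | Inr y' \<Rightarrow> mdist Y y y'))"
  have D_simps: "D (Inl x) (Inl x') = mdist X x x'" "D (Inl x) (Inr y) = r + h x y"
    "D (Inr y) (Inl x) = r + h x y" "D (Inr y) (Inr y') = mdist Y y y'" for x x' y y'
    by (simp_all add: D_def)
  have InM: "Inl x \<in> M \<longleftrightarrow> x \<in> mspace X" "Inr y \<in> M \<longleftrightarrow> y \<in> mspace Y" for x y
    by (auto simp: M_def)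
  have cross: "r + h x y \<noteq> 0" for x y using h_nonneg[of x y] r by linarith
  interpret Z: Metric_space M D
  proof
    fix u v w
    show "0 \<le> D u v" using h_nonneg r by (auto simp: D_def split: sum.split)
    show "D u v = D v u" by (auto simp: D_def mdist_commute split: sum.split)
    show "D u v = 0 \<longleftrightarrow> u = v" if "u \<in> M" "v \<in> M"
      using that cross by (auto simp: M_def D_simps)
    show "D u w \<le> D u v + D v w" if "u \<in> M" "v \<in> M" "w \<in> M"
    proof -
      have LLR: "r + h x y \<le> mdist X x z + (r + h z y)" if "x \<in> mspace X" "z \<in> mspace X" for x y z
        using hX[OF that, of y] by linarith
      have RLL: "r + h x y \<le> (r + h z y) + mdist X z x" if "x \<in> mspace X" "z \<in> mspace X" for x y z
        using hX[OF that, of y] mdist_commute[of X x z] by linarith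
      have LRR: "r + h x y \<le> (r + h x z) + mdist Y z y" if "y \<in> mspace Y" "z \<in> mspace Y" for x y z
        using hY[OF that, of x] by linarith
      have RRL: "r + h x y \<le> mdist Y y z + (r + h x z)" if "y \<in> mspace Y" "z \<in> mspace Y" for x y z
        using hY[OF that, of x] mdist_commute[of Y y z] by linarith
      have LRL: "mdist X x z \<le> (r + h x y) + (r + h z y)"
        if "x \<in> mspace X" "z \<in> mspace X" "y \<in> mspace Y" for x z y using XX[OF that] by linarith
      have RLR: "mdist Y y z \<le> (r + h x y) + (r + h x z)"
        if "y \<in> mspace Y" "z \<in> mspace Y" "x \<in> mspace X" for x z y using YY[OF that] by linarith
      show ?thesis
        by (cases u; cases v; cases w; simp only: D_simps;
            rule mdist_triangle LLR RLL LRR RRL LRL RLR; use that in \<open>auto simp: M_def\<close>)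
    qed
  qed
  have DS: "mdist Z.Self = D" and MS: "mspace Z.Self = M" by simp_all
  have "isometric_to_subset X Z.Self (Inl ` mspace X)"
    unfolding isometric_to_subset_def DS MS
    by (intro conjI exI[of _ Inl]) (auto simp: M_def D_simps)
  moreover have "isometric_to_subset Y Z.Self (Inr ` mspace Y)"
    unfolding isometric_to_subset_def DS MS
    by (intro conjI exI[of _ Inr]) (auto simp: M_def D_simps)
  ultimately have "gromov_hausdorff X Y \<le> hausdorff_dist Z.Self (Inl ` mspace X) (Inr ` mspace Y)"
    by (rule gromov_hausdorff_le)
  also have "\<dots> \<le> ereal r"
  proof (rule ereal_le_epsilon2)
    fix \<epsilon> :: real assume "\<epsilon> > 0"
    have bridge: "D (Inl x) (Inr y) < r + \<epsilon>" if "(x, y) \<in> R" for x y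
    proof -
      have "h x y \<le> 0" using h_le[OF that, of x y] RX[OF that] RY[OF that] by (simp add: mdist_self)
      then show ?thesis using \<open>\<epsilon> > 0\<close> by (simp add: D_simps)
    qed
    have "\<exists>y\<in>mspace Y. D (Inr y) (Inl x) < r + \<epsilon>" if "x \<in> mspace X" for x
      using correspondenceD(3)[OF R that] bridge RY by (metis D_simps(2,3))
    moreover have "\<exists>x\<in>mspace X. D (Inl x) (Inr y) < r + \<epsilon>" if "y \<in> mspace Y" for y
      using correspondenceD(4)[OF R that] bridge RX by metis
    ultimately have
      "Inl ` mspace X \<subseteq> (\<Union>b\<in>Inr ` mspace Y. mball_of Z.Self b (r + \<epsilon>)) \<and>
       Inr ` mspace Y \<subseteq> (\<Union>a\<in>Inl ` mspace X. mball_of Z.Self a (r + \<epsilon>))"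
      by (auto simp: in_mball_of DS MS InM)
    then show "hausdorff_dist Z.Self (Inl ` mspace X) (Inr ` mspace Y) \<le> ereal r + ereal \<epsilon>"
      unfolding hausdorff_dist_def using r \<open>\<epsilon> > 0\<close> by (intro Inf_lower) auto
  qed
  finally show ?thesis .
qed

theorem gromov_hausdorff_eq_correspondence:
  fixes X :: "'a metric" and Y :: "'b metric"
  assumes "mspace X \<noteq> {}"
  shows "gromov_hausdorff X Y =
    Inf {ereal r | r. r > 0 \<and>
      (\<exists>R. correspondence (mspace X) (mspace Y) R \<and> distortion_le X Y R (2 * r))}"
proof (rule antisym)
  show "gromov_hausdorff X Y \<le> Inf {ereal r | r. r > 0 \<and>
      (\<exists>R. correspondence (mspace X) (mspace Y) R \<and> distortion_le X Y R (2 * r))}"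
    using assms by (auto intro!: Inf_greatest gromov_hausdorff_le_correspondence)
  show "Inf {ereal r | r. r > 0 \<and>
      (\<exists>R. correspondence (mspace X) (mspace Y) R \<and> distortion_le X Y R (2 * r))}
      \<le> gromov_hausdorff X Y"
    (is "?I \<le> _")
    unfolding gromov_hausdorff_def
  proof (rule Inf_greatest, clarify)
    fix Z :: "('a + 'b) metric" and A B
    assume AB: "isometric_to_subset X Z A" "isometric_to_subset Y Z B"
    have "?I \<le> ereal r"
      if "r > 0" "A \<subseteq> (\<Union>b\<in>B. mball_of Z b r)" "B \<subseteq> (\<Union>a\<in>A. mball_of Z a r)" for r
      using correspondence_of_realization[OF AB that(2,3)] that(1) by (intro Inf_lower) auto
    then show "?I \<le> hausdorff_dist Z A B"
      unfolding hausdorff_dist_def by (intro Inf_greatest) blast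
  qed
qed

section \<open>Simplices and four-point spaces\<close>

lemma simplex_metric_simps:
  assumes "t > 0"
  shows "mspace (simplex_metric t m) = {..<m}"
    and "mdist (simplex_metric t m) i j = (if i = j then 0 else t)"
  unfolding simplex_metric_def
  using Metric_space.mspace_metric[OF Metric_space_simplex[OF assms, of m]]
    Metric_space.mdist_metric[OF Metric_space_simplex[OF assms, of m]]
  by simp_all

lemma matrix_metric_simps:
  assumes "Metric_space UNIV (\<lambda>i j. S $ i $ j)"
  shows "mspace (matrix_metric S) = UNIV" and "mdist (matrix_metric S) i j = S $ i $ j"
  unfolding matrix_metric_def
  using Metric_space.mspace_metric[OF assms] Metric_space.mdist_metric[OF assms] by simp_all

text \<open>The order in which the points split off as the number of clusters grows: capping the rank
  at \<open>m - 1\<close> gives the partition into \<open>m\<close> parts, namely \<open>4 | 123\<close>, \<open>4 | 3 | 12\<close> and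
  \<open>4 | 3 | 2 | 1\<close> for \<open>m = 2, 3, 4\<close>.\<close>

definition split_rank :: "4 \<Rightarrow> nat" where
  "split_rank x = (if x = 4 then 0 else if x = 3 then 1 else if x = 2 then 2 else 3)"

lemma split_rank_simps [simp]:
  "split_rank 1 = 3" "split_rank 2 = 2" "split_rank 3 = 1" "split_rank 4 = 0"
  by (simp_all add: split_rank_def)

locale four_point_metric =
  fixes Y :: "4 metric" and a b c d e :: real
  assumes mspace_Y: "mspace Y = UNIV"
    and order: "0 < a" "a < b" "b < c" "c < d" "d < e"
    and dist12: "mdist Y 1 2 = a" and dist13: "mdist Y 1 3 = b" and dist23: "mdist Y 2 3 = c"
    and dist24: "mdist Y 2 4 = e"
    and min_dist4: "min (mdist Y 1 4) (mdist Y 3 4) = d"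
    and max_dist4: "max (mdist Y 1 4) (mdist Y 3 4) \<le> e"
begin

lemma dist4: "d \<le> mdist Y 1 4" "d \<le> mdist Y 3 4" "mdist Y 1 4 \<le> e" "mdist Y 3 4 \<le> e"
  using min_dist4 max_dist4 by auto

lemma dist_sym:
  "mdist Y 2 1 = a" "mdist Y 3 1 = b" "mdist Y 3 2 = c" "mdist Y 4 2 = e"
  "mdist Y 4 1 = mdist Y 1 4" "mdist Y 4 3 = mdist Y 3 4"
  using dist12 dist13 dist23 dist24 by (simp_all add: mdist_commute)

lemma dist_self: "mdist Y x x = 0"
  by (simp add: mspace_Y mdist_self)

lemmas dists = dist12 dist13 dist23 dist24 dist_sym dist_self

lemma mdist_le_e: "mdist Y x y \<le> e"
  using exhaust_4[of x] exhaust_4[of y] dist4 order by (auto simp: dists)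

end

text \<open>The conditions under an upper bound on \<open>m\<close> say that few clusters are wide, those under a
  lower bound that many clusters are close together. The condition for \<open>5 \<le> m\<close> reflects that
  two simplex points must then share a point of the space.\<close>

definition admissible_distortion ::
    "real \<Rightarrow> real \<Rightarrow> real \<Rightarrow> real \<Rightarrow> real \<Rightarrow> real \<Rightarrow> nat \<Rightarrow> real \<Rightarrow> bool" where
  "admissible_distortion a b c d e t m s \<longleftrightarrow> e - t \<le> s \<and>
    (m \<le> 1 \<longrightarrow> e \<le> s) \<and> (m \<le> 2 \<longrightarrow> c \<le> s) \<and> (m \<le> 3 \<longrightarrow> a \<le> s) \<and>
    (2 \<le> m \<longrightarrow> t - d \<le> s) \<and> (3 \<le> m \<longrightarrow> t - b \<le> s) \<and> (4 \<le> m \<longrightarrow> t - a \<le> s) \<and> (5 \<le> m \<longrightarrow> t \<le> s)"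

context four_point_metric
begin

text \<open>Lower bounds. Choose a simplex point \<open>p x\<close> related to each \<open>x\<close>. Points with equal \<open>p\<close> lie
  in a common cluster, which gives the width bounds by the pigeonhole principle. If \<open>s < t - \<delta>\<close>,
  then points at distance at most \<open>\<delta>\<close> lie in one cluster only, and chaining the edges \<open>12\<close>,
  \<open>13\<close> and the shorter of \<open>14\<close>, \<open>34\<close> leaves too few clusters for \<open>m\<close> simplex points.\<close>

lemma distortion_lower_bound:
  assumes t: "t > 0" and R: "correspondence {..<m} UNIV R"
    and dis: "distortion_le (simplex_metric t m) Y R s"
  shows "admissible_distortion a b c d e t m s"
proof -
  obtain p where p: "\<And>x. (p x, x) \<in> R"
    using correspondenceD(4)[OF R] by (metis UNIV_I)
  have pm: "p x < m" for x using correspondenceD(1)[OF R p] by simp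
  have dis': "\<bar>(if i = j then 0 else t) - mdist Y x y\<bar> \<le> s"
    if "(i, x) \<in> R" "(j, y) \<in> R" for i j x y
    using distortion_leD[OF dis that] by (simp add: simplex_metric_simps[OF t])
  have same: "mdist Y x y \<le> s" if "p x = p y" for x y
    using dis'[OF p[of x] p[of y]] that by auto
  have close: "i = j" if "(i, x) \<in> R" "(j, y) \<in> R" "mdist Y x y \<le> \<delta>" "s < t - \<delta>" for i j x y \<delta>
    using dis'[OF that(1,2)] that(3,4) by (auto split: if_splits)
  \<comment> \<open>The index related to a point is then unique, so every index is some \<open>p x\<close>.\<close>
  have cover: "m = card {p 1, p 2, p 3, p 4}" if "s < t - \<delta>" "0 \<le> \<delta>" for \<delta>
  proof -
    have "i \<in> {p 1, p 2, p 3, p 4}" if im: "i < m" for i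
    proof -
      obtain x where "(i, x) \<in> R" using correspondenceD(3)[OF R, of i] im by auto
      then have "i = p x" using close[OF _ p, of i x x \<delta>] \<open>s < t - \<delta>\<close> \<open>0 \<le> \<delta>\<close> by (simp add: dist_self)
      then show ?thesis using exhaust_4[of x] by auto
    qed
    then have "{..<m} = {p 1, p 2, p 3, p 4}" using pm by auto
    then show ?thesis by (metis card_lessThan)
  qed
  have p_eq: "p x = p y" if "mdist Y x y \<le> \<delta>" "s < t - \<delta>" for x y \<delta>
    using close[OF p p] that by blast
  have "e - t \<le> s"
    using dis'[OF p[of 2] p[of 4]] t by (auto simp: dists split: if_splits)
  moreover have "e \<le> s" if "m \<le> 1"
    using same[of 2 4] pm[of 2] pm[of 4] that by (simp add: dists)
  moreover have "c \<le> s" if "m \<le> 2"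
  proof -
    have "p 2 = p 3 \<or> p 2 = p 4 \<or> p 3 = p 4" using pm[of 2] pm[of 3] pm[of 4] that by linarith
    then show ?thesis using same[of 2 3] same[of 2 4] same[of 3 4] dist4 order by (auto simp: dists)
  qed
  moreover have "a \<le> s" if "m \<le> 3"
  proof -
    have "p 1 = p 2 \<or> p 1 = p 3 \<or> p 1 = p 4 \<or> p 2 = p 3 \<or> p 2 = p 4 \<or> p 3 = p 4"
      using pm[of 1] pm[of 2] pm[of 3] pm[of 4] that by linarith
    then show ?thesis
      using same[of 1 2] same[of 1 3] same[of 1 4] same[of 2 3] same[of 2 4] same[of 3 4] dist4 order
      by (auto simp: dists)
  qed
  moreover have "t - d \<le> s" if "2 \<le> m"
  proof (rule ccontr)
    assume "\<not> t - d \<le> s"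
    then have *: "s < t - d" by simp
    have "p 1 = p 2" "p 1 = p 3" by (rule p_eq[OF _ *]; use order in \<open>simp add: dists\<close>)+
    moreover have "p 4 = p 1 \<or> p 4 = p 3"
      using p_eq[OF _ *, of 1 4] p_eq[OF _ *, of 3 4] min_dist4 by (auto simp: min_def split: if_splits)
    ultimately have "{p 1, p 2, p 3, p 4} = {p 1}" by auto
    with cover[OF *] that order show False by simp
  qed
  moreover have "t - b \<le> s" if "3 \<le> m"
  proof (rule ccontr)
    assume "\<not> t - b \<le> s"
    then have *: "s < t - b" by simp
    have "p 1 = p 2" "p 1 = p 3" by (rule p_eq[OF _ *]; use order in \<open>simp add: dists\<close>)+
    then have "{p 1, p 2, p 3, p 4} = {p 1, p 4}" by auto
    with cover[OF *] that order show False by (simp add: card_insert_if split: if_splits)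
  qed
  moreover have "t - a \<le> s" if "4 \<le> m"
  proof (rule ccontr)
    assume "\<not> t - a \<le> s"
    then have *: "s < t - a" by simp
    have "p 1 = p 2" by (rule p_eq[OF _ *]; use order in \<open>simp add: dists\<close>)
    then have "{p 1, p 2, p 3, p 4} = {p 1, p 3, p 4}" by auto
    with cover[OF *] that order show False by (simp add: card_insert_if split: if_splits)
  qed
  moreover have "t \<le> s" if "5 \<le> m"
  proof (rule ccontr)
    assume "\<not> t \<le> s"
    then have "m = card {p 1, p 2, p 3, p 4}" using cover[of 0] by simp
    then show False using that by (simp add: card_insert_if split: if_splits)
  qed
  ultimately show ?thesis by (auto simp: admissible_distortion_def)
qed

text \<open>For \<open>m \<le> 4\<close>, the correspondence below sends the points to the clusters of the partition
  with \<open>m\<close> parts; for \<open>m > 4\<close>, it sends the surplus simplex points to the point \<open>1\<close>.\<close>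

lemma correspondence_attaining_bound:
  assumes t: "t > 0" and m: "m \<ge> 1" and adm: "admissible_distortion a b c d e t m s"
  defines "R \<equiv> {(i, x). i < m \<and> min i 3 = min (split_rank x) (m - 1)}"
  shows "correspondence {..<m} UNIV R" and "distortion_le (simplex_metric t m) Y R s"
proof -
  have "\<exists>x. (i, x) \<in> R" if "i < m" for i
  proof -
    have "min i 3 \<in> {0, 1, 2, 3}" by auto
    then obtain x where "split_rank x = min i 3" by (metis insertE singletonD split_rank_simps)
    then have "(i, x) \<in> R" using that by (auto simp: R_def)
    then show ?thesis ..
  qed
  moreover have "\<exists>i. (i, x) \<in> R" for x
  proof
    \<comment> \<open>The rank is at most \<open>3\<close>, so the cap at \<open>3\<close> leaves this index unchanged.\<close>
    show "(min (split_rank x) (m - 1), x) \<in> R"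
      using m by (auto simp: R_def split_rank_def)
  qed
  ultimately show "correspondence {..<m} UNIV R"
    by (force simp: correspondence_def R_def image_iff)
  show "distortion_le (simplex_metric t m) Y R s"
    unfolding distortion_le_def
  proof clarify
    fix i x j y assume "(i, x) \<in> R" "(j, y) \<in> R"
    then have ix: "i < m" "min i 3 = min (split_rank x) (m - 1)"
      and jy: "j < m" "min j 3 = min (split_rank y) (m - 1)" by (auto simp: R_def)
    have "\<bar>(if i = j then 0 else t) - mdist Y x y\<bar> \<le> s"
    proof (cases "m \<le> 4")
      case True
      then have i: "i = min (split_rank x) (m - 1)" and j: "j = min (split_rank y) (m - 1)"
        using ix jy by linarith+
      have "m = 1 \<or> m = 2 \<or> m = 3 \<or> m = 4" using m True by linarith
      then show ?thesis
        unfolding i j using exhaust_4[of x] exhaust_4[of y] adm order dist4 t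
        by (elim disjE) (simp_all add: dists admissible_distortion_def abs_le_iff)
    next
      case False
      have "split_rank x \<le> 3" "split_rank y \<le> 3" by (auto simp: split_rank_def)
      then have "split_rank x = min i 3" "split_rank y = min j 3" using False ix jy by linarith+
      then have "split_rank x = split_rank y" if "i = j" using that by simp
      then have "x = y" if "i = j"
        using that exhaust_4[of x] exhaust_4[of y] by auto
      moreover have "\<bar>t - mdist Y x y\<bar> \<le> s"
        using mdist_le_e[of x y] adm False mdist_nonneg[of Y x y]
        unfolding admissible_distortion_def by linarith
      moreover have "0 \<le> s" using adm t False by (simp add: admissible_distortion_def)
      ultimately show ?thesis by (auto simp: dist_self)
    qed
    then show "\<bar>mdist (simplex_metric t m) i j - mdist Y x y\<bar> \<le> s"
      by (simp add: simplex_metric_simps[OF t])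
  qed
qed

theorem gromov_hausdorff_simplex:
  assumes t: "t > 0" and m: "m \<ge> 1"
  shows "gromov_hausdorff (simplex_metric t m) Y =
    Inf {ereal r | r. r > 0 \<and> admissible_distortion a b c d e t m (2 * r)}"
proof -
  have "(\<exists>R. correspondence {..<m} UNIV R \<and> distortion_le (simplex_metric t m) Y R (2 * r)) \<longleftrightarrow>
      admissible_distortion a b c d e t m (2 * r)" if "r > 0" for r
    using distortion_lower_bound[OF t, of m _ "2 * r"]
      correspondence_attaining_bound[OF t m, of "2 * r"] by auto
  moreover have "{..<m} \<noteq> {}" using m by (simp add: lessThan_empty_iff)
  ultimately show ?thesis
    by (subst gromov_hausdorff_eq_correspondence)
      (auto simp: simplex_metric_simps[OF t] mspace_Y cong: conj_cong)
qed

end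

section \<open>The two given spaces\<close>

theorem mainTheorem8:
  fixes a b c d e f :: real
  assumes "0 < a" "a < b" "b < c" "c < d" "d < f" "f < e"
    and "triangle_ineqs (matrix_S1 a b c d e f)"
    and "triangle_ineqs (matrix_S2 a b c d e f)"
  shows "\<forall>t>0. \<forall>m\<ge>1.
    gromov_hausdorff (simplex_metric t m) (matrix_metric (matrix_S1 a b c d e f)) =
    gromov_hausdorff (simplex_metric t m) (matrix_metric (matrix_S2 a b c d e f))"
proof -
  note S1 = matrix_metric_simps[OF Metric_space_S1[OF assms(1-7)]]
  note S2 = matrix_metric_simps[OF Metric_space_S2[OF assms(1-6,8)]]
  interpret X1: four_point_metric "matrix_metric (matrix_S1 a b c d e f)" a b c d e
    by unfold_locales
      (unfold S1, unfold matrix_S1_def vector_4, use assms(1-6) in simp_all)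
  interpret X2: four_point_metric "matrix_metric (matrix_S2 a b c d e f)" a b c d e
    by unfold_locales
      (unfold S2, unfold matrix_S2_def vector_4, use assms(1-6) in simp_all)
  show ?thesis by (simp add: X1.gromov_hausdorff_simplex X2.gromov_hausdorff_simplex)
qed

end
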